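(* Let $\mathcal{A}(\lambda)=\lambda\Phi_1+A+\lambda^{-1}\Phi_1^*$ be a flat affine connection with $\Phi_2=0$ and $\Phi_1$ strictly lower triangular. Then $t_k:=\operatorname{tr}\Phi_1^{k-1}A_1$ is a holomorphic $k$-differential.
   Context: $\Sigma$ is a smooth surface with local complex coordinate $z$. One considers connections with parameter $\lambda\in\mathbb{C}^*$ of the form $\mathcal{A}(\lambda)=\lambda\Phi+A+\lambda^{-1}\Phi^*$ where $\Phi$ is a $\mathfrak{sl}_n(\mathbb{C})$-valued 1-form given by an $n$-complex structure, i.e. locally $\Phi=\Phi_1dz+\Phi_2d\bar z$ with $\Phi_1$ a principal (regular) nilpotent matrix and $\Phi_2=\mu_2\Phi_1+\dots+\mu_n\Phi_1^{n-1}$ (the case $\Phi_2=0$ is the trivial $n$-complex structure), the operation $*$ is the hermitian conjugate ($M^*=M^\dagger$), and $A$ is a $\mathfrak{sl}_n(\mathbb{C})$-valued 1-form with $A^*=-A$, decomposed as $A=A_1+A_2$ into its $(1,0)$-part $A_1$ and $(0,1)$-part $A_2$. Flatness means that $d+\mathcal A(\lambda)$ has zero curvature for all $\lambda\in\mathbb{C}^*$. *)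

theory Defs
  imports "HOL-Analysis.Analysis"
begin

section \<open>Complex matrices\<close>

(* The power class operation on the type of square matrices is taken entrywise,
   so powers for the matrix product need their own definition. *)
primrec mpow :: "complex^'n^'n \<Rightarrow> nat \<Rightarrow> complex^'n^'n" where
  "mpow M 0 = mat 1"
| "mpow M (Suc k) = M ** mpow M k"

definition cscale :: "complex \<Rightarrow> complex^'n^'n \<Rightarrow> complex^'n^'n" where
  "cscale c M = map_matrix (\<lambda>x. c * x) M"

definition hconj :: "complex^'n^'n \<Rightarrow> complex^'n^'n" where
  "hconj M = (\<chi> a b. cnj (M $ b $ a))"

definition special_unitary :: "complex^'n^'n \<Rightarrow> bool" where
  "special_unitary M \<longleftrightarrow> hconj M ** M = mat 1 \<and> M ** hconj M = mat 1 \<and> det M = 1"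

definition strictly_lower_triangular :: "complex^'n::{finite,linorder}^'n::{finite,linorder} \<Rightarrow> bool" where
  "strictly_lower_triangular M \<longleftrightarrow> (\<forall>a b. a \<le> b \<longrightarrow> M $ a $ b = 0)"

(* The nilpotent Jordan block of full size: ones exactly on the first subdiagonal. *)
definition jordan_block0 :: "complex^'n::{finite,linorder}^'n::{finite,linorder}" where
  "jordan_block0 = (\<chi> a b. if b < a \<and> \<not> (\<exists>c. b < c \<and> c < a) then 1 else 0)"

definition principal_nilpotent :: "complex^'n::{finite,linorder}^'n::{finite,linorder} \<Rightarrow> bool" where
  "principal_nilpotent M \<longleftrightarrow>
     (\<exists>P :: complex^'n::{finite,linorder}^'n::{finite,linorder}. invertible P \<and>
        M = P ** jordan_block0 ** matrix_inv P)"


section \<open>Smooth functions of a complex variable\<close>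

(* Real differentiability of class C^k on an open subset of the plane; fx and fy are the
   partial derivatives in the real and the imaginary direction. *)
primrec Ck_on :: "nat \<Rightarrow> complex set \<Rightarrow> (complex \<Rightarrow> 'b::real_normed_vector) \<Rightarrow> bool" where
  "Ck_on 0 S f = continuous_on S f"
| "Ck_on (Suc k) S f = (\<exists>fx fy.
     (\<forall>w\<in>S. (f has_derivative (\<lambda>h. Re h *\<^sub>R fx w + Im h *\<^sub>R fy w)) (at w)) \<and>
     Ck_on k S fx \<and> Ck_on k S fy)"

definition smooth_on :: "complex set \<Rightarrow> (complex \<Rightarrow> 'b::real_normed_vector) \<Rightarrow> bool" where
  "smooth_on S f \<longleftrightarrow> (\<forall>k. Ck_on k S f)"

(* The Wirtinger derivatives with respect to z and to its conjugate. *)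
definition wirt :: "(complex \<Rightarrow> complex) \<Rightarrow> complex \<Rightarrow> complex" where
  "wirt f w = (frechet_derivative f (at w) 1 - \<i> * frechet_derivative f (at w) \<i>) / 2"

definition wirt_bar :: "(complex \<Rightarrow> complex) \<Rightarrow> complex \<Rightarrow> complex" where
  "wirt_bar f w = (frechet_derivative f (at w) 1 + \<i> * frechet_derivative f (at w) \<i>) / 2"

definition mwirt :: "(complex \<Rightarrow> complex^'n^'n) \<Rightarrow> complex \<Rightarrow> complex^'n^'n" where
  "mwirt M w = (\<chi> a b. wirt (\<lambda>v. M v $ a $ b) w)"

definition mwirt_bar :: "(complex \<Rightarrow> complex^'n^'n) \<Rightarrow> complex \<Rightarrow> complex^'n^'n" where
  "mwirt_bar M w = (\<chi> a b. wirt_bar (\<lambda>v. M v $ a $ b) w)"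


section \<open>Matrix-valued one-forms in a coordinate\<close>

(* MForm P Q is the one-form P dz + Q dzbar. *)
datatype 'n mform =
  MForm (dz_part: "complex \<Rightarrow> complex^'n^'n") (dzb_part: "complex \<Rightarrow> complex^'n^'n")

definition smooth_sl_form :: "complex set \<Rightarrow> ('n::finite) mform \<Rightarrow> bool" where
  "smooth_sl_form V \<omega> \<longleftrightarrow>
     smooth_on V (dz_part \<omega>) \<and> smooth_on V (dzb_part \<omega>) \<and>
     (\<forall>w\<in>V. trace (dz_part \<omega> w) = 0 \<and> trace (dzb_part \<omega> w) = 0)"

(* Hermitian conjugation of matrices exchanges dz and dzbar. *)
definition form_star :: "('n::finite) mform \<Rightarrow> 'n mform" where
  "form_star \<omega> = MForm (\<lambda>w. hconj (dzb_part \<omega> w)) (\<lambda>w. hconj (dz_part \<omega> w))"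

definition anti_hermitian_on :: "complex set \<Rightarrow> ('n::finite) mform \<Rightarrow> bool" where
  "anti_hermitian_on V \<omega> \<longleftrightarrow>
     (\<forall>w\<in>V. dz_part (form_star \<omega>) w = - dz_part \<omega> w \<and>
             dzb_part (form_star \<omega>) w = - dzb_part \<omega> w)"

definition n_complex_form_on :: "complex set \<Rightarrow> ('n::{finite,linorder}) mform \<Rightarrow> bool" where
  "n_complex_form_on V \<Phi> \<longleftrightarrow>
     (\<forall>w\<in>V. principal_nilpotent (dz_part \<Phi> w)) \<and>
     (\<exists>\<mu> :: nat \<Rightarrow> complex \<Rightarrow> complex.
        (\<forall>l\<in>{2..CARD('n)}. smooth_on V (\<mu> l)) \<and>
        (\<forall>w\<in>V. dzb_part \<Phi> w = (\<Sum>l=2..CARD('n). cscale (\<mu> l w) (mpow (dz_part \<Phi> w) (l - 1)))))"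

(* The one-form \<lambda> \<Phi> + A + \<lambda>^{-1} \<Phi>*, with spectral parameter \<lambda> = s. *)
definition affine_form :: "complex \<Rightarrow> ('n::finite) mform \<Rightarrow> 'n mform \<Rightarrow> 'n mform" where
  "affine_form s \<Phi> A = MForm
     (\<lambda>w. cscale s (dz_part \<Phi> w) + dz_part A w + cscale (inverse s) (dz_part (form_star \<Phi>) w))
     (\<lambda>w. cscale s (dzb_part \<Phi> w) + dzb_part A w + cscale (inverse s) (dzb_part (form_star \<Phi>) w))"

(* The coefficient of dz \<and> dzbar in the curvature of d + \<omega>. *)
definition curvature :: "('n::finite) mform \<Rightarrow> complex \<Rightarrow> complex^'n^'n" where
  "curvature \<omega> w = mwirt (dzb_part \<omega>) w - mwirt_bar (dz_part \<omega>) w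
     + dz_part \<omega> w ** dzb_part \<omega> w - dzb_part \<omega> w ** dz_part \<omega> w"


section \<open>Surfaces with complex coordinates\<close>

(* Coordinate change from chart i to chart j, defined on z i ` (U i \<inter> U j). *)
definition transition ::
    "('i \<Rightarrow> 'a set) \<Rightarrow> ('i \<Rightarrow> 'a \<Rightarrow> complex) \<Rightarrow> 'i \<Rightarrow> 'i \<Rightarrow> complex \<Rightarrow> complex" where
  "transition U z i j = z j \<circ> inv_into (U i) (z i)"

locale complex_surface =
  fixes X :: "'a topology" and I :: "'i set"
    and U :: "'i \<Rightarrow> 'a set" and z :: "'i \<Rightarrow> 'a \<Rightarrow> complex"
  assumes hausdorff: "Hausdorff_space X"
    and countable_base: "second_countable X"
    and cover: "(\<Union>i\<in>I. U i) = topspace X"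
    and open_domain: "i \<in> I \<Longrightarrow> openin X (U i)"
    and open_range: "i \<in> I \<Longrightarrow> open (z i ` U i)"
    and chart_homeomorphic:
      "i \<in> I \<Longrightarrow> homeomorphic_map (subtopology X (U i)) (top_of_set (z i ` U i)) (z i)"
    and holomorphic_transition:
      "\<lbrakk>i \<in> I; j \<in> I\<rbrakk> \<Longrightarrow> transition U z i j holomorphic_on z i ` (U i \<inter> U j)"

(* q i (dz i)^k is the local expression of the differential in chart i. *)
definition holomorphic_differential ::
    "'i set \<Rightarrow> ('i \<Rightarrow> 'a set) \<Rightarrow> ('i \<Rightarrow> 'a \<Rightarrow> complex) \<Rightarrow> nat \<Rightarrow> ('i \<Rightarrow> complex \<Rightarrow> complex) \<Rightarrow> bool" where
  "holomorphic_differential I U z k q \<longleftrightarrow>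
     (\<forall>i\<in>I. q i holomorphic_on z i ` U i) \<and>
     (\<forall>i\<in>I. \<forall>j\<in>I. \<forall>w \<in> z i ` (U i \<inter> U j).
        q i w = q j (transition U z i j w) * deriv (transition U z i j) w ^ k)"

(* Every chart carries a special unitary frame; g i j, a function of the coordinate z i, changes
   components in frame i to components in frame j.  The choice g i j w = mat 1 is the trivial
   bundle, where the one-forms below are global matrix-valued one-forms on the surface. *)
locale framed_surface = complex_surface X I U z
  for X :: "'a topology" and I :: "'i set"
    and U :: "'i \<Rightarrow> 'a set" and z :: "'i \<Rightarrow> 'a \<Rightarrow> complex" +
  fixes g :: "'i \<Rightarrow> 'i \<Rightarrow> complex \<Rightarrow> complex^'n::{finite,linorder}^'n::{finite,linorder}"
  assumes smooth_frame:
      "\<lbrakk>i \<in> I; j \<in> I\<rbrakk> \<Longrightarrow> smooth_on (z i ` (U i \<inter> U j)) (g i j)"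
    and unitary_frame:
      "\<lbrakk>i \<in> I; j \<in> I; w \<in> z i ` (U i \<inter> U j)\<rbrakk> \<Longrightarrow> special_unitary (g i j w)"
    and cocycle:
      "\<lbrakk>i \<in> I; j \<in> I; l \<in> I; w \<in> z i ` (U i \<inter> U j \<inter> U l)\<rbrakk> \<Longrightarrow>
         g i l w = g j l (transition U z i j w) ** g i j w"

(* \<Phi> is a tensorial one-form, whereas d + A is a connection; the transformation laws are
   the pull-backs of both along the coordinate change, conjugated by g. *)
locale affine_connection = framed_surface X I U z g
  for X :: "'a topology" and I :: "'i set"
    and U :: "'i \<Rightarrow> 'a set" and z :: "'i \<Rightarrow> 'a \<Rightarrow> complex"
    and g :: "'i \<Rightarrow> 'i \<Rightarrow> complex \<Rightarrow> complex^'n::{finite,linorder}^'n::{finite,linorder}" +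
  fixes \<Phi> A :: "'i \<Rightarrow> 'n mform"
  assumes smooth_Phi: "i \<in> I \<Longrightarrow> smooth_sl_form (z i ` U i) (\<Phi> i)"
    and smooth_A: "i \<in> I \<Longrightarrow> smooth_sl_form (z i ` U i) (A i)"
    and n_complex: "i \<in> I \<Longrightarrow> n_complex_form_on (z i ` U i) (\<Phi> i)"
    and anti_hermitian: "i \<in> I \<Longrightarrow> anti_hermitian_on (z i ` U i) (A i)"
    and change_Phi_dz: "\<lbrakk>i \<in> I; j \<in> I; w \<in> z i ` (U i \<inter> U j)\<rbrakk> \<Longrightarrow>
      dz_part (\<Phi> i) w = cscale (deriv (transition U z i j) w)
        (matrix_inv (g i j w) ** dz_part (\<Phi> j) (transition U z i j w) ** g i j w)"
    and change_Phi_dzb: "\<lbrakk>i \<in> I; j \<in> I; w \<in> z i ` (U i \<inter> U j)\<rbrakk> \<Longrightarrow>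
      dzb_part (\<Phi> i) w = cscale (cnj (deriv (transition U z i j) w))
        (matrix_inv (g i j w) ** dzb_part (\<Phi> j) (transition U z i j w) ** g i j w)"
    and change_A_dz: "\<lbrakk>i \<in> I; j \<in> I; w \<in> z i ` (U i \<inter> U j)\<rbrakk> \<Longrightarrow>
      dz_part (A i) w = cscale (deriv (transition U z i j) w)
          (matrix_inv (g i j w) ** dz_part (A j) (transition U z i j w) ** g i j w)
        + matrix_inv (g i j w) ** mwirt (g i j) w"
    and change_A_dzb: "\<lbrakk>i \<in> I; j \<in> I; w \<in> z i ` (U i \<inter> U j)\<rbrakk> \<Longrightarrow>
      dzb_part (A i) w = cscale (cnj (deriv (transition U z i j) w))
          (matrix_inv (g i j w) ** dzb_part (A j) (transition U z i j w) ** g i j w)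
        + matrix_inv (g i j w) ** mwirt_bar (g i j) w"

definition flat_affine ::
    "'i set \<Rightarrow> ('i \<Rightarrow> 'a set) \<Rightarrow> ('i \<Rightarrow> 'a \<Rightarrow> complex) \<Rightarrow>
     ('i \<Rightarrow> ('n::finite) mform) \<Rightarrow> ('i \<Rightarrow> 'n mform) \<Rightarrow> bool" where
  "flat_affine I U z \<Phi> A \<longleftrightarrow>
     (\<forall>s::complex. s \<noteq> 0 \<longrightarrow> (\<forall>i\<in>I. \<forall>w \<in> z i ` U i. curvature (affine_form s (\<Phi> i) (A i)) w = 0))"

end

theory Submission
  imports Defs
begin

text \<open>The coefficient of \<open>\<lambda>\<close> in the flatness equation is \<open>\<partial>\<^bsub>zbar\<^esub> \<Phi>\<^sub>1 = [\<Phi>\<^sub>1, A\<^sub>2]\<close>, and the coefficient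
  of \<open>\<lambda>\<^sup>0\<close> expresses \<open>\<partial>\<^bsub>zbar\<^esub> A\<^sub>1\<close> through \<open>\<partial>\<^bsub>z\<^esub> A\<^sub>2\<close> and two commutators. By cyclicity of the trace
  the commutators cancel in the derivative of \<open>t\<^sub>k\<close>, which leaves the trace of
  \<open>\<Phi>\<^sub>1\<^bsup>k-1\<^esup> \<partial>\<^bsub>z\<^esub> A\<^sub>2\<close>. A regular strictly lower triangular matrix has non-zero subdiagonal, so a
  matrix whose commutator with it is strictly lower triangular is itself lower triangular. Hence
  \<open>A\<^sub>2\<close> and \<open>\<partial>\<^bsub>z\<^esub> A\<^sub>2\<close> are lower triangular and the trace vanishes. The frame changes intertwine two
  regular strictly lower triangular matrices, so they are lower triangular for the same reason, and
  their inhomogeneous contribution to \<open>t\<^sub>k\<close> vanishes too.\<close>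

section \<open>Triangular matrices\<close>

lemma matrix_add_rdistrib: "((B :: complex^'n^'n) + C) ** A = B ** A + C ** A"
  by (simp add: vec_eq_iff matrix_matrix_mult_def algebra_simps sum.distrib)

lemma matrix_diff_ldistrib: "(A :: complex^'n^'n) ** (B - C) = A ** B - A ** C"
  by (simp add: vec_eq_iff matrix_matrix_mult_def algebra_simps sum_subtractf)

lemma matrix_diff_rdistrib: "((B :: complex^'n^'n) - C) ** A = B ** A - C ** A"
  by (simp add: vec_eq_iff matrix_matrix_mult_def algebra_simps sum_subtractf)

lemma cscale_nth [simp]: "cscale c M $ a $ b = c * M $ a $ b"
  by (simp add: cscale_def map_matrix_def)

lemma cscale_mult_left: "cscale c M ** N = cscale c (M ** N)"
  by (simp add: vec_eq_iff matrix_matrix_mult_def sum_distrib_left mult.assoc)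

lemma cscale_mult_right: "M ** cscale c N = cscale c (M ** N)"
  by (simp add: vec_eq_iff matrix_matrix_mult_def sum_distrib_left mult_ac)

lemma cscale_cscale: "cscale c (cscale d M) = cscale (c * d) M"
  by (simp add: vec_eq_iff mult.assoc)

lemma cscale_add: "cscale c (M + N) = cscale c M + cscale c N"
  by (simp add: vec_eq_iff distrib_left)

lemma cscale_1 [simp]: "cscale 1 M = M"
  by (simp add: vec_eq_iff)

lemma trace_cscale: "trace (cscale c M) = c * trace M"
  by (simp add: trace_def sum_distrib_left)

text \<open>The inner factors \<open>P ** Q\<close> telescope. The scalar is included because a
  coordinate change multiplies \<Phi> by the derivative of the transition map; \<open>c = 1\<close>
  gives plain conjugation.\<close>

lemma mpow_conjugate:
  assumes "P ** Q = mat 1" and "Q ** P = mat 1"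
  shows "mpow (cscale c (Q ** M ** P)) m = cscale (c ^ m) (Q ** mpow M m ** P)"
proof (induction m)
  case 0
  show ?case using assms by (simp add: vec_eq_iff)
next
  case (Suc m)
  have "Q ** M ** P ** (Q ** mpow M m ** P) = Q ** M ** (P ** Q) ** mpow M m ** P"
    by (simp only: matrix_mul_assoc)
  also have "\<dots> = Q ** (M ** mpow M m) ** P"
    by (simp add: assms matrix_mul_assoc)
  finally show ?case
    by (simp add: Suc cscale_mult_left cscale_mult_right cscale_cscale mult_ac)
qed

lemma mpow_commute: "mpow M m ** M = M ** mpow M m"
  by (induction m) (simp_all add: matrix_mul_assoc[symmetric])

section \<open>Lower triangular matrices and their traces\<close>

definition lower_triangular ::
    "complex^'n::{finite,linorder}^'n::{finite,linorder} \<Rightarrow> bool" where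
  "lower_triangular M \<longleftrightarrow> (\<forall>a b. a < b \<longrightarrow> M $ a $ b = 0)"

lemma lower_triangular_mult:
  fixes M N :: "complex^'n::{finite,linorder}^'n::{finite,linorder}"
  assumes "lower_triangular M" and "lower_triangular N"
  shows "lower_triangular (M ** N)"
  unfolding lower_triangular_def matrix_matrix_mult_def
proof (intro allI impI)
  fix a b :: 'n
  assume "a < b"
  have "M $ a $ c * N $ c $ b = 0" for c
    using assms \<open>a < b\<close> unfolding lower_triangular_def
    by (metis leI le_less_trans mult_eq_0_iff)
  then show "(\<chi> i j. \<Sum>k\<in>UNIV. M $ i $ k * N $ k $ j) $ a $ b = 0"
    by (simp only: vec_lambda_beta sum.neutral_const)
qed

lemma strictly_lower_triangular_mult:
  fixes M N :: "complex^'n::{finite,linorder}^'n::{finite,linorder}"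
  assumes "strictly_lower_triangular M" and "lower_triangular N"
  shows "strictly_lower_triangular (M ** N)"
  unfolding strictly_lower_triangular_def matrix_matrix_mult_def
proof (intro allI impI)
  fix a b :: 'n
  assume "a \<le> b"
  have "M $ a $ c * N $ c $ b = 0" for c
    using assms \<open>a \<le> b\<close> unfolding lower_triangular_def strictly_lower_triangular_def
    by (metis leI less_le_trans mult_eq_0_iff)
  then show "(\<chi> i j. \<Sum>k\<in>UNIV. M $ i $ k * N $ k $ j) $ a $ b = 0"
    by (simp only: vec_lambda_beta sum.neutral_const)
qed

lemma strictly_lower_imp_lower_triangular:
  "strictly_lower_triangular M \<Longrightarrow> lower_triangular M"
  by (simp add: lower_triangular_def strictly_lower_triangular_def)

lemma trace_strictly_lower_triangular: "strictly_lower_triangular M \<Longrightarrow> trace M = 0"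
  by (simp add: trace_def strictly_lower_triangular_def)

lemma strictly_lower_triangular_mpow:
  assumes "strictly_lower_triangular M"
  shows "strictly_lower_triangular (mpow M (Suc m))"
proof -
  have "lower_triangular (mpow M m)"
  proof (induction m)
    case 0
    show ?case by (simp add: lower_triangular_def mat_def)
  next
    case (Suc m)
    then show ?case
      using assms by (simp add: lower_triangular_mult strictly_lower_imp_lower_triangular)
  qed
  then show ?thesis
    using assms by (simp add: strictly_lower_triangular_mult)
qed

text \<open>A positive power supplies at least one strictly lower triangular factor, so the product
  has zero diagonal. The exponent 0 is handled elsewhere through trace-freeness of
  \<open>A\<close>.\<close>

lemma trace_mpow_lower_triangular:
  assumes "strictly_lower_triangular M" and "lower_triangular N" and "m \<noteq> 0"
  shows "trace (mpow M m ** N) = 0"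
proof -
  obtain l where "m = Suc l"
    using assms(3) not0_implies_Suc by blast
  then show ?thesis
    using assms strictly_lower_triangular_mpow
    by (intro trace_strictly_lower_triangular strictly_lower_triangular_mult) auto
qed


section \<open>The subdiagonal of a principal nilpotent matrix\<close>

text \<open>The rank, counted from 0, in the abstract index order. It identifies the indices with
  \<open>{..<CARD('n)}\<close>, so that subdiagonals can be described by addition.\<close>

definition position :: "'n::{finite,linorder} \<Rightarrow> nat" where
  "position a = card {c. c < a}"

lemma position_less: "a < b \<Longrightarrow> position a < position b"
  unfolding position_def by (rule psubset_card_mono) auto

lemma position_mono: "a \<le> b \<Longrightarrow> position a \<le> position b"
  by (metis order.order_iff_strict position_less)

lemma inj_position: "inj position"
  by (metis injI less_irrefl neqE position_less)

lemma position_less_CARD: "position (a :: 'n::{finite,linorder}) < CARD('n)"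
  unfolding position_def by (rule psubset_card_mono) auto

lemma range_position: "range (position :: 'n::{finite,linorder} \<Rightarrow> nat) = {..<CARD('n)}"
  using position_less_CARD
  by (intro card_subset_eq) (auto simp: card_image inj_position)

lemma position_Suc_iff:
  fixes a b :: "'n::{finite,linorder}"
  shows "position a = Suc (position b) \<longleftrightarrow> b < a \<and> \<not> (\<exists>c. b < c \<and> c < a)"
proof
  assume eq: "position a = Suc (position b)"
  then have "b < a"
    by (metis Suc_n_not_le_n leI position_mono)
  moreover have False if "b < c" "c < a" for c
    using position_less[OF that(1)] position_less[OF that(2)] eq by linarith
  ultimately show "b < a \<and> \<not> (\<exists>c. b < c \<and> c < a)" by blast
next
  assume *: "b < a \<and> \<not> (\<exists>c. b < c \<and> c < a)"
  then have "{c. c < a} = insert b {c. c < b}"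
    by (auto intro: less_trans) (meson linorder_neqE)
  then show "position a = Suc (position b)"
    unfolding position_def by simp
qed

text \<open>Each further factor shifts by one position, so the ones move to the \<open>m\<close>-th
  subdiagonal.\<close>

lemma mpow_jordan_block0_nth:
  "mpow (jordan_block0 :: complex^'n::{finite,linorder}^'n::{finite,linorder}) m $ a $ b
     = (if position a = position b + m then 1 else 0)"
proof (induction m arbitrary: a b)
  case 0
  show ?case by (simp add: mat_def inj_eq[OF inj_position])
next
  case (Suc m)
  have J: "(jordan_block0 :: complex^'n::{finite,linorder}^'n::{finite,linorder}) $ a $ c = (if position a = Suc (position c) then 1 else 0)" for c :: 'n
    by (simp add: jordan_block0_def position_Suc_iff)
  have "mpow (jordan_block0 :: complex^'n::{finite,linorder}^'n::{finite,linorder}) (Suc m) $ a $ b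
      = (\<Sum>c\<in>(UNIV :: 'n set). (if position a = Suc (position c) then 1 else 0)
           * (if position c = position b + m then 1 else 0))"
    by (simp add: matrix_matrix_mult_def Suc J)
  also have "\<dots> = (\<Sum>c\<in>(UNIV :: 'n set). if position a = position b + Suc m \<and> position c = position b + m
        then 1 else 0)"
    by (rule sum.cong) auto
  also have "\<dots> = (if position a = position b + Suc m then 1 else 0)"
  proof (cases "position a = position b + Suc m")
    case True
    \<comment> \<open>The intermediate index of the matrix product exists because its rank lies
      below that of \<open>a\<close>.\<close>
    then have "position b + m \<in> range (position :: 'n \<Rightarrow> nat)"
      unfolding range_position using position_less_CARD[of a] by simp
    then obtain c0 :: 'n where "position c0 = position b + m"
      by (metis imageE)
    then have "position c = position b + m \<longleftrightarrow> c = c0" for c :: 'n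
      using inj_position by (metis inj_eq)
    then show ?thesis using True by simp
  qed simp
  finally show ?case .
qed

lemma mpow_jordan_block0_nonzero:
  "mpow (jordan_block0 :: complex^'n::{finite,linorder}^'n::{finite,linorder}) (CARD('n) - 1) \<noteq> 0"
proof -
  have "0 \<in> range (position :: 'n \<Rightarrow> nat)" "CARD('n) - 1 \<in> range (position :: 'n \<Rightarrow> nat)"
    unfolding range_position by simp_all
  then obtain a b :: 'n where "position a = CARD('n) - 1" "position b = 0"
    by (metis imageE)
  then have "mpow (jordan_block0 :: complex^'n::{finite,linorder}^'n::{finite,linorder}) (CARD('n) - 1) $ a $ b = 1"
    by (simp add: mpow_jordan_block0_nth)
  then show ?thesis by auto
qed

section \<open>Inverses and conjugates of principal nilpotent matrices\<close>

lemma matrix_inv_mult: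
  assumes "invertible (P :: complex^'n^'n)"
  shows "P ** matrix_inv P = mat 1" and "matrix_inv P ** P = mat 1"
  using assms unfolding invertible_def matrix_inv_def
  by (metis (mono_tags, lifting) someI_ex)+

lemma matrix_inv_unique_left:
  assumes "P ** Q = mat 1" and "Q ** P = mat 1"
  shows "matrix_inv (P :: complex^'n^'n) = Q"
proof -
  have "invertible P"
    using assms invertible_def by blast
  then have "matrix_inv P = matrix_inv P ** (P ** Q)"
    using assms by simp
  also have "\<dots> = Q"
    using \<open>invertible P\<close> by (simp add: matrix_mul_assoc matrix_inv_mult)
  finally show ?thesis .
qed

text \<open>Conjugation carries the power of \<open>M\<close> to that of the Jordan block, which has
  a one in its last row and first column. The subdiagonal argument uses regularity in this
  form.\<close>

lemma principal_nilpotent_mpow_nonzero: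
  fixes M :: "complex^'n::{finite,linorder}^'n::{finite,linorder}"
  assumes "principal_nilpotent M"
  shows "mpow M (CARD('n) - 1) \<noteq> 0"
proof
  let ?J = "jordan_block0 :: complex^'n::{finite,linorder}^'n::{finite,linorder}"
  assume 0: "mpow M (CARD('n) - 1) = 0"
  obtain P :: "complex^'n::{finite,linorder}^'n::{finite,linorder}" where P: "invertible P" and M: "M = P ** ?J ** matrix_inv P"
    using assms principal_nilpotent_def by blast
  note inv = matrix_inv_mult[OF P]
  have "matrix_inv P ** M ** P = (matrix_inv P ** P) ** ?J ** (matrix_inv P ** P)"
    unfolding M by (simp only: matrix_mul_assoc)
  then have "?J = cscale 1 (matrix_inv P ** M ** P)"
    by (simp add: inv vec_eq_iff)
  then have "mpow ?J (CARD('n) - 1)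
      = cscale (1 ^ (CARD('n) - 1)) (matrix_inv P ** mpow M (CARD('n) - 1) ** P)"
    using mpow_conjugate[OF inv] by metis
  then show False
    using mpow_jordan_block0_nonzero[where 'n = 'n] unfolding 0
    by (auto simp: vec_eq_iff matrix_matrix_mult_def)
qed

lemma principal_nilpotent_conjugate:
  fixes M P Q :: "complex^'n::{finite,linorder}^'n::{finite,linorder}"
  assumes M: "principal_nilpotent M" and "P ** Q = mat 1" and "Q ** P = mat 1"
  shows "principal_nilpotent (P ** M ** Q)"
proof -
  obtain R :: "complex^'n::{finite,linorder}^'n::{finite,linorder}" where R: "invertible R" "M = R ** jordan_block0 ** matrix_inv R"
    using M unfolding principal_nilpotent_def by blast
  have 1: "P ** R ** (matrix_inv R ** Q) = mat 1"
    using assms R(1) by (metis matrix_inv_mult(1) matrix_mul_assoc matrix_mul_rid)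
  moreover have 2: "matrix_inv R ** Q ** (P ** R) = mat 1"
    using assms R(1) by (metis matrix_inv_mult(2) matrix_mul_assoc matrix_mul_rid)
  ultimately have "invertible (P ** R)" and "matrix_inv (P ** R) = matrix_inv R ** Q"
    using invertible_def matrix_inv_unique_left by blast+
  then show ?thesis
    unfolding principal_nilpotent_def R(2)
    by (intro exI[of _ "P ** R"]) (simp add: matrix_mul_assoc)
qed

text \<open>If the subdiagonal entry in row \<open>a'\<close> and column \<open>a\<close> vanished, every product of entries that
  passes from columns up to \<open>a\<close> to rows from \<open>a'\<close> on would gain an extra step, and the power
  \<open>n - 1\<close> would be zero.\<close>

lemma principal_nilpotent_subdiagonal_nonzero:
  fixes M :: "complex^'n::{finite,linorder}^'n::{finite,linorder}"
  assumes nil: "principal_nilpotent M" and low: "strictly_lower_triangular M"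
    and adj: "position a' = Suc (position a)"
  shows "M $ a' $ a \<noteq> 0"
proof
  assume 0: "M $ a' $ a = 0"
  \<comment> \<open>Indicates whether the entry in row \<open>x\<close> and column \<open>y\<close>
    crosses the gap between \<open>a\<close> and its successor \<open>a'\<close>.\<close>
  define jump where "jump x y = (if y \<le> a \<and> a' \<le> x then 1 else 0 :: nat)" for x y :: 'n
  \<comment> \<open>A non-zero entry advances the rank by at least 1. A crossing that advances by
    exactly 1 would be the entry in row \<open>a'\<close> and column \<open>a\<close>, which is
    assumed to vanish, so a crossing costs 2.\<close>
  have step: "position y + 1 + jump x y \<le> position x" if "M $ x $ y \<noteq> 0" for x y
  proof -
    have "y < x"
      using low that not_less unfolding strictly_lower_triangular_def by blast
    then have less: "position y < position x" by (rule position_less)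
    show ?thesis
    proof (cases "y \<le> a \<and> a' \<le> x")
      case True
      then have "position y \<le> position a" "position a' \<le> position x"
        by (auto intro: position_mono)
      moreover have "\<not> (position y = position a \<and> position x = position a')"
        using that 0 inj_position by (metis inj_eq)
      ultimately show ?thesis
        using True adj by (auto simp: jump_def)
    qed (use less in \<open>auto simp: jump_def\<close>)
  qed
  have adj': "a < a'" "c \<le> a \<or> a' \<le> c" for c
    using adj position_Suc_iff[of a' a] not_less by blast+
  have path: "position y + m + jump x y \<le> position x" if "mpow M m $ x $ y \<noteq> 0" for m x y
    using that
  proof (induction m arbitrary: x)
    case 0
    then have "x = y" by (auto simp: mat_def split: if_splits)
    then show ?case using adj'(1) by (auto simp: jump_def)
  next
    case (Suc m)
    then have "(\<Sum>c\<in>UNIV. M $ x $ c * mpow M m $ c $ y) \<noteq> 0"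
      by (simp add: matrix_matrix_mult_def)
    then obtain c where c: "M $ x $ c * mpow M m $ c $ y \<noteq> 0"
      by (meson sum.neutral)
    then have "M $ x $ c \<noteq> 0" "mpow M m $ c $ y \<noteq> 0" by auto
    with step[of x c] Suc.IH[of c]
    have "position c + 1 + jump x c \<le> position x" "position y + m + jump c y \<le> position c"
      by auto
    \<comment> \<open>Every \<open>c\<close> lies on one side of the gap, so a crossing path crosses
      in one of its two pieces.\<close>
    moreover have "jump x y \<le> jump x c + jump c y"
      using adj'(2)[of c] by (auto simp: jump_def)
    ultimately show ?case by linarith
  qed
  \<comment> \<open>\<open>CARD('n) - 1\<close> steps must lead from the first to the last index
    with no rank to spare, yet such a path crosses the gap.\<close>
  obtain x y where xy: "mpow M (CARD('n) - 1) $ x $ y \<noteq> 0"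
    using principal_nilpotent_mpow_nonzero[OF nil] by (auto simp: vec_eq_iff)
  from path[OF this] position_less_CARD[of x]
  have "position y = 0" "position x = CARD('n) - 1" "jump x y = 0"
    by auto
  moreover have "y \<le> a"
    using \<open>position y = 0\<close> position_less[of a y] by (metis leI not_less0)
  moreover have "a' \<le> x"
    using \<open>position x = _\<close> position_less[of x a'] position_less_CARD[of a']
    by (cases "x < a'") auto
  ultimately show False by (simp add: jump_def)
qed

text \<open>Downward induction on the column \<open>b\<close> and then upward induction on the row \<open>a\<close>: in the entry of
  \<open>P ** M - M ** Q\<close> in column \<open>b\<close> and in the row after \<open>a\<close>, only the term
  \<open>P $ a' $ a * M $ a $ b\<close> survives.\<close>

lemma lower_triangular_if_intertwines:
  fixes P Q M :: "complex^'n::{finite,linorder}^'n::{finite,linorder}"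
  assumes nil: "principal_nilpotent P" and P: "strictly_lower_triangular P"
    and Q: "strictly_lower_triangular Q"
    and diff: "strictly_lower_triangular (P ** M - M ** Q)"
  shows "lower_triangular M"
proof -
  have "\<forall>a<b. M $ a $ b = 0" for b :: 'n
  proof (induction "CARD('n) - position b" arbitrary: b rule: less_induct)
    case less
    \<comment> \<open>The outer induction hypothesis: columns to the right of \<open>b\<close> have
      smaller measure.\<close>
    have right: "M $ a $ c = 0" if "a < c" "b < c" for a c
      using less that position_less[of b c] position_less_CARD[of c]
      by (metis diff_less_mono2 less_trans)
    have "a < b \<longrightarrow> M $ a $ b = 0" for a
    proof (induction "position a" arbitrary: a rule: less_induct)
      case (less a)
      have above: "M $ c $ b = 0" if "c < a" "a < b" for c
        using less[OF position_less[OF that(1)]] that by auto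
      show ?case
      proof
        assume ab: "a < b"
        then have "Suc (position a) \<in> range (position :: 'n \<Rightarrow> nat)"
          unfolding range_position using position_less[OF ab] position_less_CARD[of b] by simp
        then obtain a' :: 'n where a': "position a' = Suc (position a)"
          by (metis imageE)
        then have "a < a'" and btw: "\<not> (\<exists>c. a < c \<and> c < a')"
          by (auto simp: position_Suc_iff)
        then have "a' \<le> b" using ab not_less by blast
        \<comment> \<open>Rows before \<open>a\<close> vanish in \<open>M\<close> by the inner
          induction; from \<open>a'\<close> on, strict triangularity of \<open>P\<close>
          applies.\<close>
        have "P $ a' $ c * M $ c $ b = 0" if "c \<noteq> a" for c
        proof (cases "c < a")
          case True
          then show ?thesis using above ab by simp
        next
          case False
          then have "a' \<le> c" using btw that by (meson linorder_neqE not_less)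
          then show ?thesis using P by (simp add: strictly_lower_triangular_def)
        qed
        then have "(\<Sum>c\<in>UNIV - {a}. P $ a' $ c * M $ c $ b) = 0"
          by (intro sum.neutral) simp
        then have "(P ** M) $ a' $ b = P $ a' $ a * M $ a $ b"
          by (simp add: matrix_matrix_mult_def sum.remove[of UNIV a])
        moreover have "M $ a' $ c * Q $ c $ b = 0" for c
        proof (cases "b < c")
          case True
          then show ?thesis using right[of a' c] \<open>a' \<le> b\<close> by simp
        next
          case False
          then show ?thesis using Q by (simp add: strictly_lower_triangular_def)
        qed
        then have "(M ** Q) $ a' $ b = 0"
          by (simp only: matrix_matrix_mult_def vec_lambda_beta sum.neutral_const)
        moreover have "(P ** M - M ** Q) $ a' $ b = 0"
          using diff \<open>a' \<le> b\<close> by (simp only: strictly_lower_triangular_def)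
        ultimately show "M $ a $ b = 0"
          using principal_nilpotent_subdiagonal_nonzero[OF nil P a'] by simp
      qed
    qed
    then show ?case by blast
  qed
  then show ?thesis by (simp add: lower_triangular_def)
qed


section \<open>Wirtinger derivatives\<close>

lemma wirt_eq:
  "(f has_derivative D) (at w) \<Longrightarrow> wirt f w = (D 1 - \<i> * D \<i>) / 2"
  using frechet_derivative_at wirt_def by metis

lemma wirt_bar_eq:
  "(f has_derivative D) (at w) \<Longrightarrow> wirt_bar f w = (D 1 + \<i> * D \<i>) / 2"
  using frechet_derivative_at wirt_bar_def by metis

text \<open>Functions that agree near \<open>w\<close> have the same set of derivatives there, hence
  the same chosen one. This covers the case of an empty set, where the choice is arbitrary.\<close>

lemma frechet_derivative_cong_open:
  assumes "open V" "w \<in> V" "\<And>v. v \<in> V \<Longrightarrow> f v = h v"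
  shows "frechet_derivative f (at w) = frechet_derivative h (at w)"
proof -
  have "(f has_derivative D) (at w) \<longleftrightarrow> (h has_derivative D) (at w)" for D
    using assms has_derivative_transform_within_open[of _ D w UNIV V] by metis
  then show ?thesis by (simp add: frechet_derivative_def)
qed

lemma wirt_cong_open:
  assumes "open V" "w \<in> V" "\<And>v. v \<in> V \<Longrightarrow> f v = h v"
  shows "wirt f w = wirt h w" and "wirt_bar f w = wirt_bar h w"
  using frechet_derivative_cong_open[of V w f h] assms by (simp_all add: wirt_def wirt_bar_def)

lemma wirt_const: "wirt (\<lambda>v. c) w = 0" and wirt_bar_const: "wirt_bar (\<lambda>v. c) w = 0"
  using wirt_eq[OF has_derivative_const, of c w] wirt_bar_eq[OF has_derivative_const, of c w]
  by simp_all

lemma wirt_add_cmult: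
  assumes "f differentiable (at w)" and "h differentiable (at w)"
  shows "wirt (\<lambda>v. f v + c * h v) w = wirt f w + c * wirt h w"
    and "wirt_bar (\<lambda>v. f v + c * h v) w = wirt_bar f w + c * wirt_bar h w"
proof -
  obtain D E where DE: "(f has_derivative D) (at w)" "(h has_derivative E) (at w)"
    using assms by (auto simp: differentiable_def)
  have "((\<lambda>v. f v + c * h v) has_derivative (\<lambda>t. D t + c * E t)) (at w)"
    by (intro derivative_intros DE)
  note wirts = wirt_eq[OF this] wirt_bar_eq[OF this]
  show "wirt (\<lambda>v. f v + c * h v) w = wirt f w + c * wirt h w"
    and "wirt_bar (\<lambda>v. f v + c * h v) w = wirt_bar f w + c * wirt_bar h w"
    unfolding wirts DE[THEN wirt_eq] DE[THEN wirt_bar_eq] by (simp_all add: field_simps)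
qed

lemma wirt_bar_mult:
  assumes "f differentiable (at w)" and "h differentiable (at w)"
  shows "wirt_bar (\<lambda>v. f v * h v) w = wirt_bar f w * h w + f w * wirt_bar h w"
proof -
  obtain D E where DE: "(f has_derivative D) (at w)" "(h has_derivative E) (at w)"
    using assms by (auto simp: differentiable_def)
  have "((\<lambda>v. f v * h v) has_derivative (\<lambda>t. f w * E t + D t * h w)) (at w)"
    by (intro derivative_intros DE)
  note wirt = wirt_bar_eq[OF this]
  show ?thesis
    unfolding wirt DE[THEN wirt_bar_eq] by (simp add: field_simps)
qed

lemma wirt_sum:
  fixes f :: "'a \<Rightarrow> complex \<Rightarrow> complex"
  assumes "finite S" and "\<And>i. i \<in> S \<Longrightarrow> f i differentiable (at w)"
  shows "wirt (\<lambda>v. \<Sum>i\<in>S. f i v) w = (\<Sum>i\<in>S. wirt (f i) w)"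
    and "wirt_bar (\<lambda>v. \<Sum>i\<in>S. f i v) w = (\<Sum>i\<in>S. wirt_bar (f i) w)"
  using assms
proof (induction S rule: finite_induct)
  case empty
  { case 1 show ?case by (simp add: wirt_const) }
  { case 2 show ?case by (simp add: wirt_bar_const) }
next
  case (insert i S)
  note add = wirt_add_cmult[of "f i" w "\<lambda>v. \<Sum>i\<in>S. f i v" 1]
  { case 1
    then have "(\<lambda>v. \<Sum>i\<in>S. f i v) differentiable (at w)"
      using insert.hyps by (intro differentiable_sum) auto
    then show ?case using 1 insert.IH(1) insert.hyps add(1) by simp }
  { case 2
    then have "(\<lambda>v. \<Sum>i\<in>S. f i v) differentiable (at w)"
      using insert.hyps by (intro differentiable_sum) auto
    then show ?case using 2 insert.IH(2) insert.hyps add(2) by simp }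
qed

text \<open>The Cauchy-Riemann equation makes the real-linear derivative complex linear.\<close>

lemma holomorphic_on_if_wirt_bar_eq_0:
  assumes "open V" and "\<And>w. w \<in> V \<Longrightarrow> f differentiable (at w)"
    and "\<And>w. w \<in> V \<Longrightarrow> wirt_bar f w = 0"
  shows "f holomorphic_on V"
proof (rule holomorphic_onI)
  fix w assume w: "w \<in> V"
  obtain D where D: "(f has_derivative D) (at w)"
    using assms(2)[OF w] by (auto simp: differentiable_def)
  have "D 1 + \<i> * D \<i> = 0"
    using assms(3)[OF w] wirt_bar_eq[OF D] by simp
  \<comment> \<open>Multiplication by the imaginary unit solves the equation for
    \<open>D \<i>\<close>.\<close>
  then have "\<i> * (D 1 + \<i> * D \<i>) = 0" by simp
  then have Di: "D \<i> = \<i> * D 1" by (simp add: algebra_simps)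
  interpret D: bounded_linear D using D by (rule has_derivative_bounded_linear)
  have "D = (*) (D 1)"
  proof
    fix h
    have "h = Re h *\<^sub>R 1 + Im h *\<^sub>R \<i>"
      by (simp add: complex_eq_iff)
    then have "D h = D (Re h *\<^sub>R 1 + Im h *\<^sub>R \<i>)"
      by (rule arg_cong)
    also have "\<dots> = Re h *\<^sub>R D 1 + Im h *\<^sub>R D \<i>"
      by (simp only: D.add D.scaleR)
    also have "\<dots> = D 1 * (complex_of_real (Re h) + \<i> * complex_of_real (Im h))"
      unfolding Di scaleR_conv_of_real by (simp add: algebra_simps)
    also have "\<dots> = D 1 * h"
      by (simp only: complex_eq[symmetric])
    finally show "D h = D 1 * h" .
  qed
  then have "(f has_field_derivative D 1) (at w)"
    using D by (simp add: has_field_derivative_def)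
  then show "f field_differentiable at w within V"
    using field_differentiable_at_within field_differentiable_def by blast
qed

text \<open>Entrywise, to match \<open>mwirt\<close> and \<open>mwirt_bar\<close>, which
  differentiate one entry at a time.\<close>

definition entries_differentiable :: "(complex \<Rightarrow> complex^'n^'n) \<Rightarrow> complex \<Rightarrow> bool" where
  "entries_differentiable M w \<longleftrightarrow> (\<forall>a b. (\<lambda>v. M v $ a $ b) differentiable (at w))"

lemma smooth_on_entries_differentiable:
  assumes "smooth_on V M" and "w \<in> V"
  shows "entries_differentiable M w"
proof -
  \<comment> \<open>The first-order clause of smoothness provides a derivative of the matrix-valued
    map.\<close>
  have "Ck_on (Suc 0) V M" using assms by (simp add: smooth_on_def del: Ck_on.simps)
  then obtain D where D: "(M has_derivative D) (at w)"
    using assms by auto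
  have "((\<lambda>v. M v $ a $ b) has_derivative (\<lambda>h. D h $ a $ b)) (at w)" for a b
    by (intro bounded_linear.has_derivative[OF bounded_linear_vec_nth] D)
  then show ?thesis
    unfolding entries_differentiable_def differentiable_def by blast
qed

lemma entries_differentiable_mult:
  assumes "entries_differentiable M w" and "entries_differentiable N w"
  shows "entries_differentiable (\<lambda>v. M v ** N v) w"
  using assms unfolding entries_differentiable_def matrix_matrix_mult_def
  by (auto intro!: differentiable_sum differentiable_mult)

lemma entries_differentiable_mpow:
  "entries_differentiable M w \<Longrightarrow> entries_differentiable (\<lambda>v. mpow (M v) m) w"
  by (induction m) (simp_all add: entries_differentiable_mult, simp add: entries_differentiable_def)

lemma entries_differentiable_hconj:
  assumes "entries_differentiable M w"
  shows "entries_differentiable (\<lambda>v. hconj (M v)) w"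
  unfolding entries_differentiable_def
proof (intro allI)
  fix a b
  obtain D where "((\<lambda>v. M v $ b $ a) has_derivative D) (at w)"
    using assms by (auto simp: differentiable_def entries_differentiable_def)
  from bounded_linear.has_derivative[OF bounded_linear_cnj this]
  show "(\<lambda>v. hconj (M v) $ a $ b) differentiable (at w)"
    by (auto simp: hconj_def differentiable_def)
qed

lemma differentiable_trace:
  "entries_differentiable M w \<Longrightarrow> (\<lambda>v. trace (M v)) differentiable (at w)"
  unfolding entries_differentiable_def trace_def by (auto intro!: differentiable_sum)

lemma wirt_trace:
  assumes "entries_differentiable M w"
  shows "wirt (\<lambda>v. trace (M v)) w = trace (mwirt M w)"
    and "wirt_bar (\<lambda>v. trace (M v)) w = trace (mwirt_bar M w)"
  using assms wirt_sum[of UNIV "\<lambda>a v. M v $ a $ a" w]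
  by (simp_all add: trace_def mwirt_def mwirt_bar_def entries_differentiable_def)

lemma mwirt_bar_mult:
  assumes "entries_differentiable M w" and "entries_differentiable N w"
  shows "mwirt_bar (\<lambda>v. M v ** N v) w = mwirt_bar M w ** N w + M w ** mwirt_bar N w"
proof -
  have "wirt_bar (\<lambda>v. \<Sum>c\<in>UNIV. M v $ a $ c * N v $ c $ b) w
      = (\<Sum>c\<in>UNIV. wirt_bar (\<lambda>v. M v $ a $ c) w * N w $ c $ b
           + M w $ a $ c * wirt_bar (\<lambda>v. N v $ c $ b) w)" for a b
    using assms unfolding entries_differentiable_def
    by (subst wirt_sum) (auto simp: wirt_bar_mult)
  then show ?thesis
    by (simp add: vec_eq_iff mwirt_bar_def matrix_matrix_mult_def sum.distrib)
qed

lemma mwirt_add_cscale: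
  assumes "entries_differentiable M w" and "entries_differentiable N w"
  shows "mwirt (\<lambda>v. M v + cscale c (N v)) w = mwirt M w + cscale c (mwirt N w)"
    and "mwirt_bar (\<lambda>v. M v + cscale c (N v)) w = mwirt_bar M w + cscale c (mwirt_bar N w)"
  using assms
  by (simp_all add: vec_eq_iff mwirt_def mwirt_bar_def wirt_add_cmult entries_differentiable_def)

lemma mwirt_cong_open:
  assumes "open V" "w \<in> V" "\<And>v. v \<in> V \<Longrightarrow> M v = N v"
  shows "mwirt M w = mwirt N w" and "mwirt_bar M w = mwirt_bar N w"
proof -
  have "wirt (\<lambda>v. M v $ a $ b) w = wirt (\<lambda>v. N v $ a $ b) w"
    and "wirt_bar (\<lambda>v. M v $ a $ b) w = wirt_bar (\<lambda>v. N v $ a $ b) w" for a b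
    by (rule wirt_cong_open[OF assms(1,2)]; simp add: assms(3))+
  then show "mwirt M w = mwirt N w" and "mwirt_bar M w = mwirt_bar N w"
    by (simp_all add: vec_eq_iff mwirt_def mwirt_bar_def)
qed

lemma lower_triangular_mwirt:
  assumes "open V" "w \<in> V" "\<And>v. v \<in> V \<Longrightarrow> lower_triangular (M v)"
  shows "lower_triangular (mwirt M w)"
proof -
  have "wirt (\<lambda>v. M v $ a $ b) w = 0" if "a < b" for a b
  proof -
    have "wirt (\<lambda>v. M v $ a $ b) w = wirt (\<lambda>v. 0) w"
      using assms(3) that by (intro wirt_cong_open[OF assms(1,2)]) (simp add: lower_triangular_def)
    then show ?thesis by (simp add: wirt_const)
  qed
  then show ?thesis by (simp add: lower_triangular_def mwirt_def)
qed

lemma strictly_lower_triangular_mwirt_bar: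
  assumes "open V" "w \<in> V" "\<And>v. v \<in> V \<Longrightarrow> strictly_lower_triangular (M v)"
  shows "strictly_lower_triangular (mwirt_bar M w)"
proof -
  have "wirt_bar (\<lambda>v. M v $ a $ b) w = 0" if "a \<le> b" for a b
  proof -
    have "wirt_bar (\<lambda>v. M v $ a $ b) w = wirt_bar (\<lambda>v. 0) w"
      using assms(3) that
      by (intro wirt_cong_open[OF assms(1,2)]) (simp add: strictly_lower_triangular_def)
    then show ?thesis by (simp add: wirt_bar_const)
  qed
  then show ?thesis by (simp add: strictly_lower_triangular_def mwirt_bar_def)
qed

lemma trace_mwirt_eq_0:
  assumes "open V" "w \<in> V" "\<And>v. v \<in> V \<Longrightarrow> trace (M v) = 0"
    and "entries_differentiable M w"
  shows "trace (mwirt M w) = 0"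
proof -
  have "wirt (\<lambda>v. trace (M v)) w = wirt (\<lambda>v. 0) w"
    by (rule wirt_cong_open[OF assms(1,2) assms(3)])
  then show ?thesis
    using wirt_trace(1)[OF assms(4)] by (simp add: wirt_const)
qed

text \<open>Both \<open>mwirt_bar\<close> and the commutator with \<open>B\<close> obey the product
  rule, so their agreement on \<open>M\<close> extends to powers.\<close>

lemma mwirt_bar_mpow:
  assumes "entries_differentiable M w" and "mwirt_bar M w = M w ** B - B ** M w"
  shows "mwirt_bar (\<lambda>v. mpow (M v) m) w = mpow (M w) m ** B - B ** mpow (M w) m"
proof (induction m)
  case 0
  show ?case by (simp add: vec_eq_iff mwirt_bar_def wirt_bar_const)
next
  case (Suc m)
  then show ?case
    using assms
    by (simp add: mwirt_bar_mult entries_differentiable_mpow matrix_diff_ldistrib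
        matrix_diff_rdistrib matrix_mul_assoc)
qed


section \<open>Flat connections\<close>

lemma laurent_coefficients_eq_0:
  assumes "\<And>s. s \<noteq> 0 \<Longrightarrow> cscale s X + Y + cscale (inverse s) Z = 0"
  shows "X = 0" and "Y = 0"
proof -
  have "s * X $ a $ b + Y $ a $ b + inverse s * Z $ a $ b = 0" if "s \<noteq> 0" for s a b
    using assms[OF that] by (simp add: vec_eq_iff)
  \<comment> \<open>Three parameter values suffice: adding those at 1 and -1 gives
    \<open>Y = 0\<close>, then \<open>Z = -X\<close>, and the value at 2 leaves 3/2 times
    \<open>X\<close>.\<close>
  from this[of 1] this[of "-1"] this[of 2]
  have 1: "X $ a $ b + Y $ a $ b + Z $ a $ b = 0" "- X $ a $ b + Y $ a $ b - Z $ a $ b = 0"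
      "2 * X $ a $ b + Y $ a $ b + Z $ a $ b / 2 = 0" for a b
    by simp_all
  have Y: "Y $ a $ b = 0" for a b
    using arg_cong2[OF 1(1)[of a b] 1(2)[of a b], of "(+)"] by simp
  moreover have "X $ a $ b = 0" for a b
  proof -
    have "Z $ a $ b = - X $ a $ b"
      using 1(1)[of a b] Y by (simp add: add_eq_0_iff)
    then show ?thesis using 1(3)[of a b] Y by simp
  qed
  ultimately show "X = 0" and "Y = 0" by (simp_all add: vec_eq_iff)
qed

text \<open>Since the dzbar part of \<Phi> vanishes, \<lambda> enters only the dz part of the
  connection and its inverse only the dzbar part. The curvature is therefore a Laurent polynomial
  with exponents -1, 0 and 1, and its two upper coefficients are compared with 0.\<close>

lemma flat_affine_form_equations:
  assumes V: "open V" "w \<in> V" and smooth: "smooth_sl_form V \<Phi>" "smooth_sl_form V A"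
    and dzb: "\<And>v. v \<in> V \<Longrightarrow> dzb_part \<Phi> v = 0"
    and flat: "\<And>s. s \<noteq> 0 \<Longrightarrow> curvature (affine_form s \<Phi> A) w = 0"
  shows "mwirt_bar (dz_part \<Phi>) w = dz_part \<Phi> w ** dzb_part A w - dzb_part A w ** dz_part \<Phi> w"
    and "mwirt_bar (dz_part A) w = mwirt (dzb_part A) w
      + (dz_part A w ** dzb_part A w - dzb_part A w ** dz_part A w)
      + (dz_part \<Phi> w ** hconj (dz_part \<Phi> w) - hconj (dz_part \<Phi> w) ** dz_part \<Phi> w)"
proof -
  define F C B H where "F = dz_part \<Phi> w" and "C = dz_part A w" and "B = dzb_part A w"
    and "H = hconj F"
  have diff: "entries_differentiable (dz_part \<Phi>) w" "entries_differentiable (dz_part A) w"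
      "entries_differentiable (dzb_part A) w"
    using smooth V smooth_on_entries_differentiable unfolding smooth_sl_form_def by blast+
  define dH where "dH = mwirt (\<lambda>v. hconj (dz_part \<Phi> v)) w"
  have eq: "dz_part (affine_form s \<Phi> A) v = dz_part A v + cscale s (dz_part \<Phi> v)"
      "dzb_part (affine_form s \<Phi> A) v = dzb_part A v + cscale (inverse s) (hconj (dz_part \<Phi> v))"
    if "v \<in> V" for s v
    using dzb[OF that] by (simp_all add: affine_form_def form_star_def hconj_def vec_eq_iff)
  have d_dzb: "mwirt (dzb_part (affine_form s \<Phi> A)) w
      = mwirt (dzb_part A) w + cscale (inverse s) dH" for s
  proof -
    have "mwirt (dzb_part (affine_form s \<Phi> A)) w
        = mwirt (\<lambda>v. dzb_part A v + cscale (inverse s) (hconj (dz_part \<Phi> v))) w"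
      by (rule mwirt_cong_open(1)[OF V]) (rule eq(2))
    then show ?thesis
      unfolding dH_def by (simp add: mwirt_add_cscale diff entries_differentiable_hconj)
  qed
  have d_dz: "mwirt_bar (dz_part (affine_form s \<Phi> A)) w
      = mwirt_bar (dz_part A) w + cscale s (mwirt_bar (dz_part \<Phi>) w)" for s
  proof -
    have "mwirt_bar (dz_part (affine_form s \<Phi> A)) w
        = mwirt_bar (\<lambda>v. dz_part A v + cscale s (dz_part \<Phi> v)) w"
      by (rule mwirt_cong_open(2)[OF V]) (rule eq(1))
    then show ?thesis by (simp add: mwirt_add_cscale diff)
  qed
  \<comment> \<open>The coefficients of \<lambda>, of 1 and of the inverse of \<lambda> in the
    curvature.\<close>
  define X Y Z where "X = F ** B - B ** F - mwirt_bar (dz_part \<Phi>) w"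
    and "Y = mwirt (dzb_part A) w + (C ** B - B ** C) + (F ** H - H ** F) - mwirt_bar (dz_part A) w"
    and "Z = dH + C ** H - H ** C"
  have "cscale s X + Y + cscale (inverse s) Z = 0" if "s \<noteq> 0" for s
  proof -
    have "curvature (affine_form s \<Phi> A) w
        = mwirt (dzb_part A) w + cscale (inverse s) dH
          - (mwirt_bar (dz_part A) w + cscale s (mwirt_bar (dz_part \<Phi>) w))
          + (C + cscale s F) ** (B + cscale (inverse s) H)
          - (B + cscale (inverse s) H) ** (C + cscale s F)"
      unfolding curvature_def d_dzb d_dz eq[OF V(2)] by (simp add: F_def C_def B_def H_def)
    also have "(C + cscale s F) ** (B + cscale (inverse s) H)
        = C ** B + cscale s (F ** B) + cscale (inverse s) (C ** H) + F ** H"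
      using that by (simp add: matrix_add_ldistrib matrix_add_rdistrib cscale_mult_left
          cscale_mult_right cscale_cscale cscale_add)
    also have "(B + cscale (inverse s) H) ** (C + cscale s F)
        = B ** C + cscale s (B ** F) + cscale (inverse s) (H ** C) + H ** F"
      using that by (simp add: matrix_add_ldistrib matrix_add_rdistrib cscale_mult_left
          cscale_mult_right cscale_cscale cscale_add)
    finally show ?thesis
      unfolding X_def Y_def Z_def flat[OF that] by (simp add: vec_eq_iff algebra_simps)
  qed
  from laurent_coefficients_eq_0[OF this] have "X = 0" "Y = 0" by blast+
  then show "mwirt_bar (dz_part \<Phi>) w = dz_part \<Phi> w ** dzb_part A w - dzb_part A w ** dz_part \<Phi> w"
    and "mwirt_bar (dz_part A) w = mwirt (dzb_part A) w
      + (dz_part A w ** dzb_part A w - dzb_part A w ** dz_part A w)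
      + (dz_part \<Phi> w ** hconj (dz_part \<Phi> w) - hconj (dz_part \<Phi> w) ** dz_part \<Phi> w)"
    by (simp_all add: X_def Y_def F_def C_def B_def H_def)
qed

text \<open>By cyclicity the trace of \<open>K [C,B]\<close> cancels that of \<open>[K,B] C\<close>,
  and the trace of \<open>K [F,H]\<close> equals that of \<open>[K,F] H\<close>, where
  \<open>[K,F] = 0\<close>. In the application \<open>K\<close> is a power of
  \<open>F\<close>.\<close>

lemma trace_commutator_cancel:
  fixes K B C F H :: "complex^'n^'n"
  assumes "K ** F = F ** K"
  shows "trace ((K ** B - B ** K) ** C + K ** (D + (C ** B - B ** C) + (F ** H - H ** F)))
    = trace (K ** D)"
proof -
  have "trace (B ** (K ** C)) = trace (K ** C ** B)" "trace (K ** (H ** F)) = trace (K ** (F ** H))"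
    using trace_mul_sym[of B "K ** C"] trace_mul_sym[of "K ** H" F] assms
    by (simp_all add: matrix_mul_assoc)
  then show ?thesis
    by (simp add: matrix_diff_rdistrib matrix_diff_ldistrib matrix_add_ldistrib trace_add trace_sub
        matrix_mul_assoc)
qed

lemma trace_mpow_holomorphic:
  fixes \<Phi> A :: "'n::{finite,linorder} mform"
  assumes V: "open V" and smooth: "smooth_sl_form V \<Phi>" "smooth_sl_form V A"
    and nil: "\<And>w. w \<in> V \<Longrightarrow> principal_nilpotent (dz_part \<Phi> w)"
    and low: "\<And>w. w \<in> V \<Longrightarrow> strictly_lower_triangular (dz_part \<Phi> w)"
    and dzb: "\<And>w. w \<in> V \<Longrightarrow> dzb_part \<Phi> w = 0"
    and flat: "\<And>s w. s \<noteq> 0 \<Longrightarrow> w \<in> V \<Longrightarrow> curvature (affine_form s \<Phi> A) w = 0"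
  shows "(\<lambda>w. trace (mpow (dz_part \<Phi> w) m ** dz_part A w)) holomorphic_on V"
proof (rule holomorphic_on_if_wirt_bar_eq_0[OF V])
  have eqs:
    "mwirt_bar (dz_part \<Phi>) w = dz_part \<Phi> w ** dzb_part A w - dzb_part A w ** dz_part \<Phi> w"
    "mwirt_bar (dz_part A) w = mwirt (dzb_part A) w
      + (dz_part A w ** dzb_part A w - dzb_part A w ** dz_part A w)
      + (dz_part \<Phi> w ** hconj (dz_part \<Phi> w) - hconj (dz_part \<Phi> w) ** dz_part \<Phi> w)"
    if "w \<in> V" for w
    using flat_affine_form_equations[OF V that smooth dzb flat[OF _ that]] by blast+
  \<comment> \<open>The commutator of \<Phi> with the dzbar part of \<open>A\<close> is a derivative
    of strictly lower triangular matrices, so its entries on and above the diagonal vanish.\<close>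
  have lowA: "lower_triangular (dzb_part A w)" if w: "w \<in> V" for w
  proof (rule lower_triangular_if_intertwines[OF nil[OF w] low[OF w] low[OF w]])
    show "strictly_lower_triangular
        (dz_part \<Phi> w ** dzb_part A w - dzb_part A w ** dz_part \<Phi> w)"
      unfolding eqs(1)[OF w, symmetric] by (rule strictly_lower_triangular_mwirt_bar[OF V w low])
  qed
  fix w assume w: "w \<in> V"
  have diff: "entries_differentiable (dz_part \<Phi>) w" "entries_differentiable (dz_part A) w"
      "entries_differentiable (dzb_part A) w"
    using smooth w smooth_on_entries_differentiable unfolding smooth_sl_form_def by blast+
  note prod = entries_differentiable_mult[OF entries_differentiable_mpow[OF diff(1)] diff(2)]
  show "(\<lambda>w. trace (mpow (dz_part \<Phi> w) m ** dz_part A w)) differentiable (at w)"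
    by (intro differentiable_trace prod)
  \<comment> \<open>Needed for \<open>m = 0\<close>, where the power is the identity and
    triangularity does not make the trace vanish.\<close>
  have "trace (mwirt (dzb_part A) w) = 0"
    using smooth(2) by (intro trace_mwirt_eq_0[OF V w] diff) (simp add: smooth_sl_form_def)
  then have "trace (mpow (dz_part \<Phi> w) m ** mwirt (dzb_part A) w) = 0"
    using trace_mpow_lower_triangular[OF low[OF w] lower_triangular_mwirt[OF V w lowA]]
    by (cases "m = 0") simp_all
  then show "wirt_bar (\<lambda>w. trace (mpow (dz_part \<Phi> w) m ** dz_part A w)) w = 0"
    unfolding wirt_trace(2)[OF prod]
      mwirt_bar_mult[OF entries_differentiable_mpow[OF diff(1)] diff(2)]
      mwirt_bar_mpow[OF diff(1) eqs(1)[OF w]] eqs(2)[OF w]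
    by (simp add: trace_commutator_cancel[OF mpow_commute])
qed


section \<open>Changes of charts and frames\<close>

context complex_surface
begin

text \<open>Provides the open domain on which the frame change \<open>g i j\<close> is
  differentiated.\<close>

lemma open_overlap:
  assumes "i \<in> I" "j \<in> I"
  shows "open (z i ` (U i \<inter> U j))"
proof -
  have "openin (subtopology X (U i)) (U i \<inter> U j)"
    using open_domain[OF assms(2)] by (auto simp: openin_subtopology)
  then have "openin (top_of_set (z i ` U i)) (z i ` (U i \<inter> U j))"
    using homeomorphic_imp_open_map[OF chart_homeomorphic[OF assms(1)]]
    by (auto simp: open_map_def)
  then show ?thesis
    using open_range[OF assms(1)] openin_open_eq by blast
qed

lemma transition_in_chart:
  assumes "i \<in> I" "w \<in> z i ` (U i \<inter> U j)"
  shows "transition U z i j w \<in> z j ` U j"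
proof -
  have "topspace (subtopology X (U i)) = U i"
    using openin_subset[OF open_domain[OF assms(1)]] by auto
  then have "inj_on (z i) (U i)"
    using homeomorphic_imp_injective_map[OF chart_homeomorphic[OF assms(1)]] by simp
  then show ?thesis
    using assms(2) by (auto simp: transition_def)
qed

end

text \<open>Conjugation rewrites as the intertwining relations
  \<open>cscale c N ** P = P ** M\<close> and \<open>M ** Q = Q ** cscale c N\<close>. The scalar
  stays attached to \<open>N\<close>, and \<open>cscale c N\<close> inherits regularity as a
  conjugate of \<open>M\<close>.\<close>

lemma lower_triangular_conjugator:
  fixes P Q M N :: "complex^'n::{finite,linorder}^'n::{finite,linorder}"
  assumes PQ: "P ** Q = mat 1" "Q ** P = mat 1" and M: "M = cscale c (Q ** N ** P)"
    and nil: "principal_nilpotent M"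
    and low: "strictly_lower_triangular M" "strictly_lower_triangular N"
  shows "lower_triangular P" and "lower_triangular Q"
proof -
  have "P ** (Q ** N ** P) ** Q = (P ** Q) ** N ** (P ** Q)"
    by (simp only: matrix_mul_assoc)
  then have conj: "P ** M ** Q = cscale c N"
    by (simp add: M cscale_mult_left cscale_mult_right PQ)
  have low': "strictly_lower_triangular (cscale c N)"
    using low(2) by (simp add: strictly_lower_triangular_def)
  have nil': "principal_nilpotent (cscale c N)"
    using principal_nilpotent_conjugate[OF nil PQ] conj by simp
  have "cscale c N ** P = P ** M ** (Q ** P)" "Q ** cscale c N = (Q ** P) ** M ** Q"
    unfolding conj[symmetric] by (simp_all only: matrix_mul_assoc)
  then have "cscale c N ** P - P ** M = 0" "M ** Q - Q ** cscale c N = 0"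
    by (simp_all add: PQ)
  moreover have "strictly_lower_triangular (0 :: complex^'n::{finite,linorder}^'n::{finite,linorder})"
    by (simp add: strictly_lower_triangular_def)
  ultimately show "lower_triangular P" and "lower_triangular Q"
    using lower_triangular_if_intertwines[OF nil' low' low(1)]
      lower_triangular_if_intertwines[OF nil low(1) low'] by metis+
qed

lemma trace_conjugate_mult:
  fixes P Q M N :: "complex^'n^'n"
  assumes PQ: "P ** Q = mat 1" "Q ** P = mat 1"
  shows "trace ((Q ** M ** P) ** (Q ** N ** P)) = trace (M ** N)"
proof -
  have "(Q ** M ** P) ** (Q ** N ** P) = Q ** (M ** (P ** Q) ** N ** P)"
    by (simp only: matrix_mul_assoc)
  then have "trace ((Q ** M ** P) ** (Q ** N ** P)) = trace (M ** N ** P ** Q)"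
    by (simp add: PQ trace_mul_sym[of Q])
  also have "M ** N ** P ** Q = M ** N ** (P ** Q)"
    by (simp only: matrix_mul_assoc)
  finally show ?thesis by (simp add: PQ)
qed

text \<open>The power of \<Phi> contributes \<open>m\<close> factors of the derivative of the
  transition and \<open>A\<close> one more, hence \<open>Suc m\<close>. The inhomogeneous term in
  the change of \<open>A\<close> is lower triangular and has no effect on the trace when
  \<open>m\<close> is positive.\<close>

lemma (in affine_connection) trace_mpow_change:
  assumes ij: "i \<in> I" "j \<in> I" and w: "w \<in> z i ` (U i \<inter> U j)"
    and low: "\<And>i w. \<lbrakk>i \<in> I; w \<in> z i ` U i\<rbrakk> \<Longrightarrow> strictly_lower_triangular (dz_part (\<Phi> i) w)"
  shows "trace (mpow (dz_part (\<Phi> i) w) m ** dz_part (A i) w)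
    = trace (mpow (dz_part (\<Phi> j) (transition U z i j w)) m ** dz_part (A j) (transition U z i j w))
      * deriv (transition U z i j) w ^ Suc m"
proof -
  let ?t = "transition U z i j"
  have sub: "v \<in> z i ` U i" "?t v \<in> z j ` U j" if "v \<in> z i ` (U i \<inter> U j)" for v
    using that transition_in_chart[OF ij(1)] by auto
  show ?thesis
  proof (cases "m = 0")
    case True
    \<comment> \<open>For exponent 0 both sides are zero because \<open>A\<close> is trace-free in
      either chart.\<close>
    then show ?thesis
      using smooth_A[OF ij(1)] smooth_A[OF ij(2)] sub[OF w]
      by (simp add: smooth_sl_form_def del: ball_simps)
  next
    case False
    define Q where "Q v = matrix_inv (g i j v)" for v
    have inv: "g i j v ** Q v = mat 1" "Q v ** g i j v = mat 1"
      if "v \<in> z i ` (U i \<inter> U j)" for v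
      using unitary_frame[OF ij that] unfolding Q_def special_unitary_def
      by (metis invertible_def matrix_inv_mult)+
    have lowg: "lower_triangular (g i j v)" "lower_triangular (Q v)"
      if v: "v \<in> z i ` (U i \<inter> U j)" for v
    proof -
      have "principal_nilpotent (dz_part (\<Phi> i) v)"
        using n_complex[OF ij(1)] sub(1)[OF v] unfolding n_complex_form_on_def by blast
      from lower_triangular_conjugator[OF inv[OF v] change_Phi_dz[OF ij v, folded Q_def] this
          low[OF ij(1) sub(1)[OF v]] low[OF ij(2) sub(2)[OF v]]]
      show "lower_triangular (g i j v)" "lower_triangular (Q v)" by blast+
    qed
    let ?P = "g i j w"
    let ?K = "mpow (dz_part (\<Phi> j) (?t w)) m" and ?N = "dz_part (A j) (?t w)"
    let ?d = "deriv ?t w"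
    have pow: "mpow (dz_part (\<Phi> i) w) m = cscale (?d ^ m) (Q w ** ?K ** ?P)"
      unfolding change_Phi_dz[OF ij w, folded Q_def] by (rule mpow_conjugate[OF inv[OF w]])
    \<comment> \<open>The frame change is lower triangular on the whole open overlap, so its
      derivative at \<open>w\<close> is too.\<close>
    have "lower_triangular (Q w ** mwirt (g i j) w)"
      by (intro lower_triangular_mult lowg(2)[OF w]
          lower_triangular_mwirt[OF open_overlap[OF ij] w lowg(1)])
    then have 0: "trace (mpow (dz_part (\<Phi> i) w) m ** (Q w ** mwirt (g i j) w)) = 0"
      using trace_mpow_lower_triangular[OF low[OF ij(1) sub(1)[OF w]]] False by blast
    have "trace (mpow (dz_part (\<Phi> i) w) m ** dz_part (A i) w)
        = trace (mpow (dz_part (\<Phi> i) w) m ** cscale ?d (Q w ** ?N ** ?P))"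
      unfolding change_A_dz[OF ij w, folded Q_def] by (simp add: matrix_add_ldistrib trace_add 0)
    also have "\<dots> = ?d ^ Suc m * trace ((Q w ** ?K ** ?P) ** (Q w ** ?N ** ?P))"
      unfolding pow by (simp add: cscale_mult_left cscale_mult_right cscale_cscale trace_cscale)
    also have "\<dots> = trace (?K ** ?N) * ?d ^ Suc m"
      unfolding trace_conjugate_mult[OF inv[OF w]] by (rule mult.commute)
    finally show ?thesis .
  qed
qed

theorem proposition11p4:
  fixes X :: "'a topology" and I :: "'i set"
    and U :: "'i \<Rightarrow> 'a set" and z :: "'i \<Rightarrow> 'a \<Rightarrow> complex"
    and g :: "'i \<Rightarrow> 'i \<Rightarrow> complex \<Rightarrow> complex^'n::{finite,linorder}^'n::{finite,linorder}"
    and \<Phi> A :: "'i \<Rightarrow> 'n mform" and k :: nat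
  assumes "affine_connection X I U z g \<Phi> A"
    and "flat_affine I U z \<Phi> A"
    and "\<And>i w. \<lbrakk>i \<in> I; w \<in> z i ` U i\<rbrakk> \<Longrightarrow> dzb_part (\<Phi> i) w = 0"
    and "\<And>i w. \<lbrakk>i \<in> I; w \<in> z i ` U i\<rbrakk> \<Longrightarrow> strictly_lower_triangular (dz_part (\<Phi> i) w)"
    and "k \<ge> 1"
  shows "holomorphic_differential I U z k
           (\<lambda>i w. trace (mpow (dz_part (\<Phi> i) w) (k - 1) ** dz_part (A i) w))"
proof -
  interpret affine_connection X I U z g \<Phi> A by fact
  \<comment> \<open>With \<open>k\<close> at least 1 the truncated subtraction is exact, so the
    derivative appears to the power \<open>k\<close>.\<close>
  have k: "Suc (k - 1) = k" using assms(5) by simp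
  show ?thesis
    unfolding holomorphic_differential_def
  proof (intro conjI ballI)
    fix i assume i: "i \<in> I"
    show "(\<lambda>w. trace (mpow (dz_part (\<Phi> i) w) (k - 1) ** dz_part (A i) w))
        holomorphic_on z i ` U i"
    proof (rule trace_mpow_holomorphic)
      show "principal_nilpotent (dz_part (\<Phi> i) w)" if "w \<in> z i ` U i" for w
        using n_complex[OF i] that unfolding n_complex_form_on_def by blast
      show "curvature (affine_form s (\<Phi> i) (A i)) w = 0" if "s \<noteq> 0" "w \<in> z i ` U i" for s w
        using assms(2) i that unfolding flat_affine_def by blast
    qed (use i assms(3,4) open_range smooth_Phi smooth_A in auto)
  qed (use trace_mpow_change[where m = "k - 1", unfolded k] assms(4) in auto)
qed

end
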